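(* Let $x_1,x_2$ be binary features, $a$ a binary sensitive attribute and $y$ a binary class label (all with values in $\{0,1\}$), and let $f$ be the label classifier given by $f(x_1,x_2,a)=x_2$. Then there exists a joint distribution $Q$ over tuples $(x_1,x_2,a,y)$ such that the bias of $f$ is zero, i.e. $\mathrm{bias}_Q(f)=0$, whereas using the Bayes optimal predictor $\hat a$ for the attribute $a$ in place of $a$ leads to an estimated bias of one for $f$, i.e. $$\big|\mathbb{P}_Q(f=1\mid y=1,\hat a=1)-\mathbb{P}_Q(f=1\mid y=1,\hat a=0)\big|=1.$$
   Context: For a label classifier $f$ and a distribution $Q$, the (equal opportunity) bias is $\mathrm{bias}_Q(f)=|\alpha-\beta|$, where $\alpha=\mathbb{P}_Q(f=1\mid y=1,a=1)$ and $\beta=\mathbb{P}_Q(f=1\mid y=1,a=0)$. An attribute classifier predicts $a$ from the features $(x_1,x_2)$ only. The Bayes optimal predictor $\hat a=\hat a(x_1,x_2)$ for $a$ outputs a value maximizing $\mathbb{P}_Q(a=\cdot\mid x_1,x_2)$ (arbitrary in case of ties or on feature values of probability zero). The estimated bias is obtained by replacing $a$ by $\hat a$ in the definition of the bias. *)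

theory Defs
  imports "HOL-Probability.Probability"
begin

text \<open>
  Binary values are encoded as \<^typ>\<open>bool\<close>, with \<^term>\<open>True\<close> standing for 1 and \<^term>\<open>False\<close> for 0.
  A sample is a tuple \<open>(x1, x2, a, y)\<close>; every distribution on this finite type is a pmf.
\<close>

type_synonym sample = "bool \<times> bool \<times> bool \<times> bool"
type_synonym label_classifier = "bool \<Rightarrow> bool \<Rightarrow> bool \<Rightarrow> bool"
type_synonym attr_classifier = "bool \<Rightarrow> bool \<Rightarrow> bool"

definition prediction :: "label_classifier \<Rightarrow> sample \<Rightarrow> bool" where
  "prediction f = (\<lambda>(x1, x2, a, y). f x1 x2 a)"

definition label :: "sample \<Rightarrow> bool" where
  "label = (\<lambda>(x1, x2, a, y). y)"

definition attribute :: "sample \<Rightarrow> bool" where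
  "attribute = (\<lambda>(x1, x2, a, y). a)"

definition estimated_attribute :: "attr_classifier \<Rightarrow> sample \<Rightarrow> bool" where
  "estimated_attribute h = (\<lambda>(x1, x2, a, y). h x1 x2)"

text \<open>
  The equal opportunity bias with respect to a group indicator \<open>g\<close>, which is either the true or an
  estimated attribute.  Since \<^const>\<open>cond_prob\<close> is 0 when the conditioning event is null,
  \<open>groups_nonnull\<close> records separately that both conditional probabilities are meaningful.
\<close>

definition group_bias :: "sample pmf \<Rightarrow> (sample \<Rightarrow> bool) \<Rightarrow> label_classifier \<Rightarrow> real" where
  "group_bias Q g f =
     \<bar>\<P>(\<omega> in measure_pmf Q. prediction f \<omega> = True \<bar> label \<omega> = True \<and> g \<omega> = True)
      - \<P>(\<omega> in measure_pmf Q. prediction f \<omega> = True \<bar> label \<omega> = True \<and> g \<omega> = False)\<bar>"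

definition groups_nonnull :: "sample pmf \<Rightarrow> (sample \<Rightarrow> bool) \<Rightarrow> bool" where
  "groups_nonnull Q g \<longleftrightarrow>
     (\<forall>v. \<P>(\<omega> in measure_pmf Q. label \<omega> = True \<and> g \<omega> = v) > 0)"

definition bias :: "sample pmf \<Rightarrow> label_classifier \<Rightarrow> real" where
  "bias Q f = group_bias Q attribute f"

definition estimated_bias :: "sample pmf \<Rightarrow> attr_classifier \<Rightarrow> label_classifier \<Rightarrow> real" where
  "estimated_bias Q h f = group_bias Q (estimated_attribute h) f"

text \<open>
  On feature values of probability zero both conditional probabilities below are 0, so the predictor
  is unconstrained there, as it is in case of ties.
\<close>

definition bayes_optimal :: "sample pmf \<Rightarrow> attr_classifier \<Rightarrow> bool" where
  "bayes_optimal Q h \<longleftrightarrow>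
     (\<forall>u v b.
        \<P>((x1, x2, a, y) in measure_pmf Q. a = b \<bar> x1 = u \<and> x2 = v)
        \<le> \<P>((x1, x2, a, y) in measure_pmf Q. a = h u v \<bar> x1 = u \<and> x2 = v))"

lemma bayes_optimal_exists: "\<exists>h. bayes_optimal Q h"
proof -
  obtain p where p: "\<And>u v b.
    \<P>((x1, x2, a, y) in measure_pmf Q. a = b \<bar> x1 = u \<and> x2 = v) = (p u v b :: real)"
    by (rule that) (rule refl)
  have "bayes_optimal Q (\<lambda>u v. p u v False \<le> p u v True)"
    unfolding bayes_optimal_def p
  proof (intro allI)
    fix u v b
    show "p u v b \<le> p u v (p u v False \<le> p u v True)"
      by (cases b; cases "p u v False \<le> p u v True") simp_all
  qed
  then show ?thesis by blast
qed

end

theory Submission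
  imports Defs
begin

text \<open>
  Let \<open>x1\<close> be constantly 0.  Among the positives, \<open>x2\<close> and \<open>a\<close> are independent and uniform, so the
  bias of \<open>x2\<close> vanishes; among the negatives \<open>a = x2\<close>.  Overall \<open>a = x2\<close> is therefore more likely
  than not given \<open>x2\<close>, hence the Bayes predictor is \<open>x2\<close> itself and separates \<open>f = 1\<close> from \<open>f = 0\<close>.
\<close>

definition Q_support :: "sample set" where
  "Q_support = {(False, False, False, False), (False, True, True, False),
     (False, False, False, True), (False, False, True, True),
     (False, True, False, True), (False, True, True, True)}"

definition Q_witness :: "sample pmf" where
  "Q_witness = pmf_of_set Q_support"

text \<open>Summing indicators over an explicit six-point set lets the simplifier evaluate every
  probability below.\<close>

lemma prob_Q_witness:
  "measure_pmf.prob Q_witness A = (\<Sum>\<omega>\<in>Q_support. of_bool (\<omega> \<in> A)) / 6"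
proof -
  have "finite Q_support" "Q_support \<noteq> {}" "card Q_support = 6"
    by (simp_all add: Q_support_def)
  then show ?thesis
    by (simp add: Q_witness_def measure_pmf_of_set flip: of_nat_sum)
qed

lemmas Q_witness_simps = prob_Q_witness cond_prob_def Q_support_def
  prediction_def label_def attribute_def estimated_attribute_def

text \<open>Given \<open>x1 = False\<close> and \<open>x2 = v\<close>, three support points remain
  and two of them have \<open>a = v\<close>: 2/3 against 1/3, so no tie.\<close>

lemma bayes_optimal_Q_witness:
  assumes "bayes_optimal Q_witness h"
  shows "h False v = v"
proof (rule ccontr)
  assume "h False v \<noteq> v"
  moreover have "\<P>((x1, x2, a, y) in measure_pmf Q_witness. a = v \<bar> x1 = False \<and> x2 = v)
      \<le> \<P>((x1, x2, a, y) in measure_pmf Q_witness. a = h False v \<bar> x1 = False \<and> x2 = v)"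
    using assms unfolding bayes_optimal_def by blast
  ultimately show False
    by (cases v) (simp_all add: Q_witness_simps)
qed

theorem theorem1:
  fixes f :: label_classifier
  assumes "\<And>x1 x2 a. f x1 x2 a = x2"
  shows "\<exists>Q :: sample pmf.
           groups_nonnull Q attribute \<and> bias Q f = 0 \<and>
           (\<forall>ahat. bayes_optimal Q ahat \<longrightarrow>
              groups_nonnull Q (estimated_attribute ahat) \<and> estimated_bias Q ahat f = 1)"
proof (intro exI[of _ Q_witness] conjI allI impI)
  show "groups_nonnull Q_witness attribute"
    unfolding groups_nonnull_def all_bool_eq by (simp add: Q_witness_simps)
  show "bias Q_witness f = 0"
    unfolding bias_def group_bias_def by (simp add: Q_witness_simps assms)
next
  fix ahat
  assume "bayes_optimal Q_witness ahat"
  \<comment> \<open>The values of \<open>ahat\<close> at \<open>x1 = True\<close> stay unknown, but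
    no mass lies there. Among positives the estimated groups are exactly \<open>x2 = 1\<close> and
    \<open>x2 = 0\<close>, with conditional probabilities 1 and 0.\<close>
  note ahat = bayes_optimal_Q_witness[OF this]
  show "groups_nonnull Q_witness (estimated_attribute ahat)"
    unfolding groups_nonnull_def all_bool_eq by (simp add: Q_witness_simps ahat)
  show "estimated_bias Q_witness ahat f = 1"
    unfolding estimated_bias_def group_bias_def by (simp add: Q_witness_simps assms ahat)
qed

end
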